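(* For every $n\ge 4$, the star $S_n=K_{n-1,1}$ is $\mathcal{P}$-unique.
   Context: Graphs are finite and simple. For $S\subseteq V(G)$, $S$ is a power dominating set if, after coloring $S$, coloring every neighbor of a vertex of $S$, and then repeatedly applying the forcing rule (a colored vertex with exactly one uncolored neighbor colors that neighbor) until no changes occur, all vertices are colored. $\mathcal{P}(G;x)=\sum_{i=1}^{|V(G)|}p(G;i)x^i$, where $p(G;i)$ is the number of power dominating sets of size $i$. A graph $G$ is $\mathcal{P}$-unique if every graph $H$ with $\mathcal{P}(H;x)=\mathcal{P}(G;x)$ is isomorphic to $G$. *)

theory Defs
  imports
    "Graph_Theory.Graph_Theory"
    "HOL-Computational_Algebra.Polynomial"
begin

text \<open>
  A finite simple graph is a digraph satisfying the locale predicate \<open>graph\<close>: finite, loop-free,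
  without parallel arcs and symmetric, an edge being represented by its two opposite arcs.
  On such digraphs \<open>digraph_iso\<close> is graph isomorphism.
\<close>

definition neighbors :: "('a, 'b) pre_digraph \<Rightarrow> 'a \<Rightarrow> 'a set" where
  "neighbors G u = {v. u \<rightarrow>\<^bsub>G\<^esub> v}"

definition force_step :: "('a, 'b) pre_digraph \<Rightarrow> 'a set \<Rightarrow> 'a set \<Rightarrow> bool" where
  "force_step G C C' \<longleftrightarrow> (\<exists>u\<in>C. \<exists>v. neighbors G u - C = {v} \<and> C' = insert v C)"

text \<open>
  Forcing is confluent (a force that is available stays available, or its target gets colored, when
  other forces are performed first) and \<open>verts G\<close> admits no further force.
  Hence the process ends in \<open>verts G\<close> iff \<open>verts G\<close> is reachable.
\<close>

definition power_dominating :: "('a, 'b) pre_digraph \<Rightarrow> 'a set \<Rightarrow> bool" where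
  "power_dominating G S \<longleftrightarrow>
     S \<subseteq> verts G \<and> (force_step G)\<^sup>*\<^sup>* (S \<union> (\<Union>u\<in>S. neighbors G u)) (verts G)"

definition num_power_dominating :: "('a, 'b) pre_digraph \<Rightarrow> nat \<Rightarrow> nat" where
  "num_power_dominating G i = card {S. power_dominating G S \<and> card S = i}"

definition power_dom_poly :: "('a, 'b) pre_digraph \<Rightarrow> int poly" where
  "power_dom_poly G = (\<Sum>i = 1..card (verts G). monom (int (num_power_dominating G i)) i)"

text \<open>
  A definition cannot quantify over types, so the type of the competing graphs \<open>H\<close> is a parameter;
  results are to be stated with this type left arbitrary.
\<close>

definition P_unique :: "('c, 'd) pre_digraph itself \<Rightarrow> ('a, 'b) pre_digraph \<Rightarrow> bool" where
  "P_unique _ G \<longleftrightarrow> graph G \<and>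
     (\<forall>H :: ('c, 'd) pre_digraph.
        graph H \<and> power_dom_poly H = power_dom_poly G \<longrightarrow> digraph_iso H G)"

end

theory Submission
  imports Defs
begin

text \<open>
  A set of leaves of the star power dominates only if it misses at most one leaf. Hence the power
  dominating sets of size \<open>n - 3\<close> are exactly the sets of that size containing the center.
  Let \<open>H\<close> have the same polynomial. It has \<open>n\<close> vertices and some power dominating set \<open>{c}\<close>, so \<open>H\<close>
  is connected, and all supersets of \<open>{c}\<close> power dominate. These already account for all power
  dominating sets of size \<open>n - 3\<close>, so no complement of three vertices including \<open>c\<close> power dominates.
  If there were an edge between \<open>a, b \<noteq> c\<close>, choose a further vertex \<open>w\<close>: the failure of the
  complement of \<open>{c, b, w}\<close> shows that \<open>c\<close> is adjacent to \<open>b\<close> but not to \<open>a\<close>, contradicting the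
  symmetry between \<open>a\<close> and \<open>b\<close>. Hence every edge contains \<open>c\<close>.
\<close>

section \<open>Forcing: monotonicity and obstructions\<close>

text \<open>Induction along the forcing sequence from \<open>C\<close>: the target \<open>v\<close>
  of its first force either lies in \<open>D\<close> already or is the only neighbor of
  \<open>u\<close> outside \<open>D\<close>, so that the same force is available from
  \<open>D\<close>.\<close>

lemma force_steps_mono:
  assumes "(force_step G)\<^sup>*\<^sup>* C (verts G)" "C \<subseteq> D" "D \<subseteq> verts G" "wf_digraph G"
  shows "(force_step G)\<^sup>*\<^sup>* D (verts G)"
  using assms(1-3)
proof (induction arbitrary: D rule: converse_rtranclp_induct)
  case base
  then show ?case by auto
next
  case (step C C')
  then obtain u v where uv: "u \<in> C" "neighbors G u - C = {v}" "C' = insert v C"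
    by (auto simp: force_step_def)
  show ?case
  proof (cases "v \<in> D")
    case True
    with uv step show ?thesis by auto
  next
    case False
    with uv step.prems have "force_step G D (insert v D)"
      by (auto simp: force_step_def)
    moreover have "v \<in> verts G"
      using uv wf_digraph.adj_in_verts(2)[OF assms(4)] by (auto simp: neighbors_def)
    with uv step have "(force_step G)\<^sup>*\<^sup>* (insert v D) (verts G)"
      by (intro step.IH) auto
    ultimately show ?thesis by (rule converse_rtranclp_into_rtranclp)
  qed
qed

lemma neighbors_subset_verts: "wf_digraph G \<Longrightarrow> neighbors G u \<subseteq> verts G"
  using wf_digraph.adj_in_verts(2) by (fastforce simp: neighbors_def)

lemma power_dominating_mono:
  assumes "power_dominating G S" "S \<subseteq> T" "T \<subseteq> verts G" "wf_digraph G"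
  shows "power_dominating G T"
  unfolding power_dominating_def
proof
  show "(force_step G)\<^sup>*\<^sup>* (T \<union> (\<Union>u\<in>T. neighbors G u)) (verts G)"
  proof (rule force_steps_mono)
    show "(force_step G)\<^sup>*\<^sup>* (S \<union> (\<Union>u\<in>S. neighbors G u)) (verts G)"
      using assms(1) by (simp add: power_dominating_def)
    show "S \<union> (\<Union>u\<in>S. neighbors G u) \<subseteq> T \<union> (\<Union>u\<in>T. neighbors G u)"
      using assms(2) by auto
    show "T \<union> (\<Union>u\<in>T. neighbors G u) \<subseteq> verts G"
      using assms(3) neighbors_subset_verts[OF assms(4)] by auto
  qed (fact assms(4))
qed (fact assms(3))

lemma power_dominating_subset: "power_dominating G S \<Longrightarrow> S \<subseteq> verts G"
  by (simp add: power_dominating_def)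

lemma power_dominating_verts:
  assumes "wf_digraph G"
  shows "power_dominating G (verts G)"
proof -
  have "verts G \<union> (\<Union>u\<in>verts G. neighbors G u) = verts G"
    using neighbors_subset_verts[OF assms] by blast
  then show ?thesis by (simp add: power_dominating_def)
qed

text \<open>A force colors the head of an arc whose tail is colored, so a set that no arc enters
  from outside stays uncolored.\<close>

lemma force_steps_disjoint:
  assumes "(force_step G)\<^sup>*\<^sup>* C D" "C \<inter> A = {}"
    and "\<And>u x. x \<in> A \<Longrightarrow> u \<rightarrow>\<^bsub>G\<^esub> x \<Longrightarrow> u \<in> A"
  shows "D \<inter> A = {}"
  using assms(1,2)
proof (induction rule: rtranclp_induct)
  case (step D D')
  then show ?case using assms(3) by (fastforce simp: force_step_def neighbors_def)
qed

text \<open>This stands in for connectedness: for \<open>S = {c}\<close>, every nonempty vertex set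
  avoiding \<open>c\<close> is entered by an edge. Otherwise neither the domination step nor any
  later force could reach \<open>A\<close>.\<close>

lemma power_dominating_edge_into:
  assumes "power_dominating G S" "A \<subseteq> verts G" "A \<noteq> {}" "A \<inter> S = {}"
  obtains u x where "x \<in> A" "u \<notin> A" "u \<rightarrow>\<^bsub>G\<^esub> x"
proof (rule ccontr)
  assume "\<not> thesis"
  with that have cl: "\<And>u x. x \<in> A \<Longrightarrow> u \<rightarrow>\<^bsub>G\<^esub> x \<Longrightarrow> u \<in> A" by blast
  have "(S \<union> (\<Union>u\<in>S. neighbors G u)) \<inter> A = {}"
    using assms(4) cl by (fastforce simp: neighbors_def)
  with assms(1) have "verts G \<inter> A = {}"
    unfolding power_dominating_def using force_steps_disjoint cl by metis
  with assms(2,3) show False by blast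
qed

section \<open>Coefficients and degree of the polynomial\<close>

lemma coeff_power_dom_poly:
  "coeff (power_dom_poly G) i =
     (if i \<in> {1..card (verts G)} then int (num_power_dominating G i) else 0)"
  by (simp add: power_dom_poly_def coeff_sum sum.delta' if_distrib cong: if_cong)

text \<open>The full vertex set always power dominates, so the top coefficient is nonzero. Hence the
  polynomial determines the order of the graph.\<close>

lemma degree_power_dom_poly:
  assumes "graph G"
  shows "degree (power_dom_poly G) = card (verts G)"
proof (cases "card (verts G) = 0")
  \<comment> \<open>The sum is empty here, and the zero polynomial has degree 0 by
    convention.\<close>
  case True
  then show ?thesis by (simp add: power_dom_poly_def)
next
  case False
  interpret graph G by fact
  have "verts G \<in> {S. power_dominating G S \<and> card S = card (verts G)}"
    using power_dominating_verts[OF wf_digraph] by simp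
  moreover have "finite {S. power_dominating G S \<and> card S = card (verts G)}"
    by (rule finite_subset[of _ "Pow (verts G)"]) (auto simp: power_dominating_def)
  ultimately have "num_power_dominating G (card (verts G)) \<noteq> 0"
    unfolding num_power_dominating_def by (metis card_0_eq empty_iff)
  with False have "coeff (power_dom_poly G) (card (verts G)) \<noteq> 0"
    by (simp add: coeff_power_dom_poly Suc_le_eq del: card_0_eq card_eq_0_iff)
  moreover have "degree (power_dom_poly G) \<le> card (verts G)"
    by (rule degree_le) (simp add: coeff_power_dom_poly)
  ultimately show ?thesis by (meson le_degree le_antisym)
qed

text \<open>Deleting \<open>c\<close> is a bijection onto the \<open>k\<close>-subsets of the rest.
  The count is applied to the center of the star and to a power dominating singleton of the
  competing graph.\<close>

lemma card_supersets_singleton: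
  assumes "finite V" "c \<in> V" "card V = n"
  shows "card {S. S \<subseteq> V \<and> c \<in> S \<and> card S = Suc k} = (n - 1) choose k"
proof -
  have "{S. S \<subseteq> V \<and> c \<in> S \<and> card S = Suc k} = insert c ` {T. T \<subseteq> V - {c} \<and> card T = k}"
    (is "?L = ?R")
  proof
    show "?L \<subseteq> ?R"
    proof
      fix S assume "S \<in> ?L"
      then have "S = insert c (S - {c})" "S - {c} \<subseteq> V - {c}" "card (S - {c}) = k"
        using assms finite_subset by (auto simp: card_Diff_singleton)
      then show "S \<in> ?R" by blast
    qed
    show "?R \<subseteq> ?L"
    proof
      fix S assume "S \<in> ?R"
      then obtain T where T: "S = insert c T" "T \<subseteq> V - {c}" "card T = k" by blast
      with assms(1) have "finite T" "c \<notin> T" using finite_subset by blast+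
      with T assms(2) show "S \<in> ?L" by auto
    qed
  qed
  moreover have "inj_on (insert c) {T. T \<subseteq> V - {c} \<and> card T = k}"
    by (auto simp: inj_on_def)
  ultimately show ?thesis
    using assms by (simp add: card_image n_subsets)
qed

section \<open>Stars and their isomorphisms\<close>

definition star_centered :: "('a, 'b) pre_digraph \<Rightarrow> 'a \<Rightarrow> bool" where
  "star_centered G c \<longleftrightarrow> graph G \<and> c \<in> verts G \<and>
     arcs_ends G = (verts G - {c}) \<times> {c} \<union> {c} \<times> (verts G - {c})"

lemma complete_bipartite_digraph_star_centered:
  assumes "K\<^bsub>n - 1,1\<^esub> G" "n > 0"
  obtains c where "star_centered G c" "card (verts G) = n"
proof -
  obtain U V where UV: "graph G" "verts G = U \<union> V" "U \<inter> V = {}" "card U = n - 1" "card V = 1"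
    "arcs_ends G = U \<times> V \<union> V \<times> U"
    using assms(1) unfolding complete_bipartite_digraph_def by blast
  interpret graph G by fact
  obtain c where c: "V = {c}" using UV(5) by (auto simp: card_1_singleton_iff)
  have "finite U" using finite_verts UV(2) by simp
  with UV c assms(2) have "card (verts G) = n" by simp
  moreover have "U = verts G - {c}" using UV c by auto
  with UV c have "star_centered G c" unfolding star_centered_def by auto
  ultimately show ?thesis using that by blast
qed

text \<open>Without parallel arcs, an arc is determined by its ends, so a vertex bijection that
  respects ends lifts to the arcs.\<close>

lemma digraph_isoI:
  assumes "nomulti_digraph H" "nomulti_digraph G"
    and f: "bij_betw f (verts H) (verts G)"
    and ends: "arcs_ends G = map_prod f f ` arcs_ends H"
  shows "digraph_iso H G"
proof -
  interpret H: nomulti_digraph H by fact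
  interpret G: nomulti_digraph G by fact
  define g where "g a = the_inv_into (arcs G) (arc_to_ends G) (map_prod f f (arc_to_ends H a))" for a
  have bijG: "bij_betw (arc_to_ends G) (arcs G) (arcs_ends G)"
    using G.inj_on_arc_to_ends by (simp add: bij_betw_def arcs_ends_def)
  have bijH: "bij_betw (arc_to_ends H) (arcs H) (arcs_ends H)"
    using H.inj_on_arc_to_ends by (simp add: bij_betw_def arcs_ends_def)
  have "arcs_ends H \<subseteq> verts H \<times> verts H"
    using H.adj_in_verts by auto
  moreover have "inj_on (map_prod f f) (verts H \<times> verts H)"
    using f by (auto simp: bij_betw_def intro: map_prod_inj_on)
  ultimately have "bij_betw (map_prod f f) (arcs_ends H) (arcs_ends G)"
    unfolding ends by (auto simp: bij_betw_def intro: inj_on_subset)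
  from bij_betw_trans[OF bij_betw_trans[OF bijH this] bij_betw_the_inv_into[OF bijG]]
  have g: "bij_betw g (arcs H) (arcs G)"
    by (simp add: g_def comp_def cong: bij_betw_cong)
  have g_ends: "arc_to_ends G (g a) = map_prod f f (arc_to_ends H a)" if "a \<in> arcs H" for a
    unfolding g_def
  proof (rule f_the_inv_into_f[OF G.inj_on_arc_to_ends])
    show "map_prod f f (arc_to_ends H a) \<in> arc_to_ends G ` arcs G"
      using that ends unfolding arcs_ends_def by blast
  qed
  \<comment> \<open>The head and tail maps are those of the target, so that
    \<open>app_iso h H\<close> is literally \<open>G\<close>.\<close>
  define h where
    "h = \<lparr>iso_verts = f, iso_arcs = g, iso_head = head G, iso_tail = tail G\<rparr>"
  have "pre_digraph.digraph_isomorphism H h"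
    using f g g_ends H.wf_digraph unfolding pre_digraph.digraph_isomorphism_def h_def
    by (auto simp: bij_betw_def arc_to_ends_def)
  moreover have "G = app_iso h H"
    using f g by (simp add: app_iso_def h_def bij_betw_def)
  ultimately show ?thesis unfolding digraph_iso_def by blast
qed

lemma star_centered_iso:
  assumes H: "star_centered H d" and G: "star_centered G c"
    and card: "card (verts H) = card (verts G)"
  shows "digraph_iso H G"
proof -
  interpret H: graph H using H by (simp add: star_centered_def)
  interpret G: graph G using G by (simp add: star_centered_def)
  have d: "d \<in> verts H" and c: "c \<in> verts G" using H G by (auto simp: star_centered_def)
  obtain f0 where f0: "bij_betw f0 (verts H - {d}) (verts G - {c})"
    using finite_same_card_bij[of "verts H - {d}" "verts G - {c}"] card c d
    by (auto simp: card_Diff_singleton)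
  define f where "f = f0(d := c)"
  have img: "f ` (verts H - {d}) = verts G - {c}" and fd: "f d = c"
    using f0 by (auto simp: f_def bij_betw_def)
  have inj: "inj_on f (verts H - {d})"
    using f0 by (auto simp: f_def bij_betw_def inj_on_def)
  have V: "verts H = insert d (verts H - {d})" "verts G = insert c (verts G - {c})"
    using c d by auto
  have "inj_on f (insert d (verts H - {d}))"
    using inj img fd by (subst inj_on_insert) auto
  moreover have "f ` insert d (verts H - {d}) = insert c (verts G - {c})"
    by (simp only: image_insert img fd)
  ultimately have "bij_betw f (verts H) (verts G)"
    unfolding bij_betw_def using V by metis
  moreover have "arcs_ends G = map_prod f f ` arcs_ends H"
  proof -
    have "arcs_ends H = (verts H - {d}) \<times> {d} \<union> {d} \<times> (verts H - {d})"
      "arcs_ends G = (verts G - {c}) \<times> {c} \<union> {c} \<times> (verts G - {c})"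
      using H G by (auto simp: star_centered_def)
    then show ?thesis
      by (simp only: image_Un map_prod_surj_on[OF img, of f "{d}" "{c}"]
          map_prod_surj_on[OF _ img, of f "{d}" "{c}"] image_insert image_empty fd)
  qed
  ultimately show ?thesis
    using H.nomulti_digraph G.nomulti_digraph digraph_isoI by blast
qed

section \<open>Power domination in stars\<close>

lemma star_centered_neighbors:
  assumes "star_centered G c"
  shows "neighbors G u = (if u = c then verts G - {c} else if u \<in> verts G then {c} else {})"
  using assms by (auto simp: neighbors_def star_centered_def)

lemma star_power_dominating_center:
  assumes "star_centered G c" "S \<subseteq> verts G" "c \<in> S"
  shows "power_dominating G S"
proof -
  have "S \<union> (\<Union>u\<in>S. neighbors G u) = verts G"
    using assms by (auto simp: star_centered_neighbors[OF assms(1)] split: if_splits)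
  then show ?thesis using assms(2) by (simp add: power_dominating_def)
qed

text \<open>The domination step adds at most the center, so at least two leaves stay uncolored. Then
  no force exists at all: the center has too many uncolored neighbors, and the leaves in
  \<open>S\<close> have none.\<close>

lemma star_not_power_dominating:
  assumes star: "star_centered G c" and S: "c \<notin> S" "card S + 3 = card (verts G)"
  shows "\<not> power_dominating G S"
proof
  assume pd: "power_dominating G S"
  interpret graph G using star by (simp add: star_centered_def)
  have sub: "S \<subseteq> verts G" using pd by (simp add: power_dominating_def)
  define C where "C = S \<union> (\<Union>u\<in>S. neighbors G u)"
  have C: "C \<subseteq> insert c S" "S \<subseteq> C"
    using S sub by (auto simp: C_def star_centered_neighbors[OF star] split: if_splits)
  have fin: "finite S" using sub finite_verts by (rule finite_subset)
  have "card C \<le> Suc (card S)"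
    using C(1) fin by (metis card_insert_disjoint S(1) card_mono finite_insert)
  then have "C \<noteq> verts G" using S by auto
  moreover have "(force_step G)\<^sup>*\<^sup>* C (verts G)" using pd by (simp add: power_dominating_def C_def)
  ultimately obtain C' where "force_step G C C'" by (meson converse_rtranclpE)
  then obtain u v where u: "u \<in> C" "neighbors G u - C = {v}" by (auto simp: force_step_def)
  show False
  proof (cases "u = c")
    case True
    with u have "(verts G - {c}) - C = {v}" by (simp add: star_centered_neighbors[OF star])
    then have "verts G \<subseteq> insert v (insert c S)" using C by auto
    then have "card (verts G) \<le> card (insert v (insert c S))" using fin by (intro card_mono) auto
    also have "\<dots> \<le> card S + 2" using fin by (simp add: card_insert_if)
    finally show False using S by simp
  next
    case False
    with u C have "u \<in> S" by auto
    with u show False by (auto simp: C_def)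
  qed
qed

section \<open>Recognizing a star by its failing sets\<close>

lemma star_centeredI:
  assumes H: "graph H" and c: "power_dominating H {c}" and n: "card (verts H) \<ge> 4"
    and nopd: "\<And>S. S \<subseteq> verts H \<Longrightarrow> c \<notin> S \<Longrightarrow> card S + 3 = card (verts H) \<Longrightarrow>
                 \<not> power_dominating H S"
  shows "star_centered H c"
proof -
  interpret graph H by fact
  have cV: "c \<in> verts H" using c by (simp add: power_dominating_def)
  have sym: "v \<rightarrow>\<^bsub>H\<^esub> u" if "u \<rightarrow>\<^bsub>H\<^esub> v" for u v
    using that sym_arcs arcs_ends_symmetric by metis
  \<comment> \<open>No vertex is isolated. For \<open>c\<close> itself, an edge entering the
    complement of \<open>c\<close> must start at \<open>c\<close>, and symmetry reverses it.\<close>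
  have has_neighbor: "\<exists>u. u \<in> verts H \<and> u \<noteq> x \<and> u \<rightarrow>\<^bsub>H\<^esub> x" if x: "x \<in> verts H" for x
  proof (cases "x = c")
    case True
    have "card (verts H - {c}) \<noteq> 0" using n cV by (simp add: card_Diff_singleton)
    then have "verts H - {c} \<noteq> {}" by (metis card.empty)
    then obtain u y where uy: "y \<in> verts H - {c}" "u \<notin> verts H - {c}" "u \<rightarrow>\<^bsub>H\<^esub> y"
      using power_dominating_edge_into[OF c, of "verts H - {c}"] by blast
    with adj_in_verts have "u = c" by blast
    with uy sym True show ?thesis by blast
  next
    case False
    with x obtain u y where "y \<in> {x}" "u \<notin> {x}" "u \<rightarrow>\<^bsub>H\<^esub> y"
      by (auto intro: power_dominating_edge_into[OF c, of "{x}"])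
    with adj_in_verts show ?thesis by blast
  qed
  \<comment> \<open>A single missing vertex can always be forced, by any of its neighbors.\<close>
  have last: "(force_step H)\<^sup>*\<^sup>* (verts H - {x}) (verts H)" if x: "x \<in> verts H" for x
  proof -
    obtain u where "u \<in> verts H" "u \<noteq> x" "u \<rightarrow>\<^bsub>H\<^esub> x" using has_neighbor[OF x] by blast
    moreover have "neighbors H u \<subseteq> verts H" by (rule neighbors_subset_verts) (rule wf_digraph)
    ultimately have "neighbors H u - (verts H - {x}) = {x}" "u \<in> verts H - {x}"
      "verts H = insert x (verts H - {x})"
      using x by (auto simp: neighbors_def)
    then have "force_step H (verts H - {x}) (verts H)" unfolding force_step_def by blast
    then show ?thesis by blast
  qed
  have key: "c \<rightarrow>\<^bsub>H\<^esub> b \<and> \<not> a \<rightarrow>\<^bsub>H\<^esub> c" if ab: "a \<rightarrow>\<^bsub>H\<^esub> b" "a \<noteq> c" "b \<noteq> c" for a b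
  proof -
    have V: "a \<in> verts H" "b \<in> verts H" "a \<noteq> b" using ab adj_in_verts adj_not_same by blast+
    have "\<not> verts H \<subseteq> {a, b, c}"
    proof
      assume "verts H \<subseteq> {a, b, c}"
      then have "card (verts H) \<le> card {a, b, c}" by (intro card_mono) auto
      also have "\<dots> \<le> 3" by (simp add: card_insert_if)
      finally show False using n by simp
    qed
    \<comment> \<open>A fourth vertex exists because the order is at least 4.\<close>
    then obtain w where w: "w \<in> verts H" "w \<noteq> a" "w \<noteq> b" "w \<noteq> c" by blast
    define T where "T = verts H - {c, b, w}"
    define C where "C = T \<union> (\<Union>u\<in>T. neighbors H u)"
    have "card T + 3 = card (verts H)"
    proof -
      have "card T = card (verts H) - card {c, b, w}"
        unfolding T_def using V w cV by (intro card_Diff_subset) auto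
      moreover have "card {c, b, w} = 3" using ab w by simp
      ultimately show ?thesis using n by simp
    qed
    then have "\<not> power_dominating H T" by (intro nopd) (auto simp: T_def)
    then have fail: "\<not> (force_step H)\<^sup>*\<^sup>* C (verts H)"
      by (auto simp: power_dominating_def T_def C_def)
    have CV: "C \<subseteq> verts H"
      using neighbors_subset_verts[OF wf_digraph] by (auto simp: C_def T_def)
    have aT: "a \<in> T" using V ab w by (auto simp: T_def)
    then have "b \<in> C" using ab by (auto simp: C_def neighbors_def)
    \<comment> \<open>Only \<open>c\<close> and \<open>w\<close> can be uncolored after the
      domination step, and both must be: with just one of them missing, \<open>last\<close> would
      finish.\<close>
    then have sub: "verts H - {c, w} \<subseteq> C" by (auto simp: C_def T_def)
    have fail': "\<not> (force_step H)\<^sup>*\<^sup>* D (verts H)" if "D \<subseteq> C" for D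
      using fail force_steps_mono[OF _ that CV wf_digraph] by blast
    have "c \<notin> C"
    proof
      assume "c \<in> C"
      with sub have "verts H - {w} \<subseteq> C" by blast
      with fail' last w show False by blast
    qed
    have "w \<notin> C"
    proof
      assume "w \<in> C"
      with sub have "verts H - {c} \<subseteq> C" by blast
      with fail' last cV show False by blast
    qed
    have not_adj: "\<not> t \<rightarrow>\<^bsub>H\<^esub> c" "\<not> t \<rightarrow>\<^bsub>H\<^esub> w" if "t \<in> T" for t
      using that \<open>c \<notin> C\<close> \<open>w \<notin> C\<close> by (auto simp: C_def neighbors_def)
    \<comment> \<open>Some edge joins \<open>c\<close> or \<open>w\<close> to the remaining
      vertices. Its other end cannot lie in \<open>T\<close>, whose vertices are adjacent to
      neither, so it is \<open>b\<close>.\<close>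
    obtain u x where ux: "x \<in> verts H - {c, w}" "u \<notin> verts H - {c, w}" "u \<rightarrow>\<^bsub>H\<^esub> x"
      using V ab w by (auto intro: power_dominating_edge_into[OF c, of "verts H - {c, w}"])
    then have u: "u = c \<or> u = w" using adj_in_verts by blast
    have "x = b" using ux u not_adj[of x] sym by (auto simp: T_def)
    have "c \<rightarrow>\<^bsub>H\<^esub> b"
    proof (rule ccontr)
      \<comment> \<open>The edge then joins \<open>b\<close> to \<open>w\<close>, which is the only
        uncolored neighbor of \<open>b\<close>. So \<open>b\<close> forces \<open>w\<close>, and
        \<open>last\<close> supplies \<open>c\<close>, contradicting the failure of
        \<open>T\<close>.\<close>
      assume ncb: "\<not> c \<rightarrow>\<^bsub>H\<^esub> b"
      with u ux \<open>x = b\<close> have "b \<rightarrow>\<^bsub>H\<^esub> w" using sym by blast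
      with ncb sym w have "neighbors H b - (verts H - {c, w}) = {w}"
        using neighbors_subset_verts[OF wf_digraph, of b] by (auto simp: neighbors_def)
      moreover have "b \<in> verts H - {c, w}" using V ab w by auto
      moreover have "verts H - {c} = insert w (verts H - {c, w})" using w by auto
      ultimately have "force_step H (verts H - {c, w}) (verts H - {c})"
        unfolding force_step_def by blast
      with last[OF cV] have "(force_step H)\<^sup>*\<^sup>* (verts H - {c, w}) (verts H)"
        by (rule converse_rtranclp_into_rtranclp[rotated])
      with fail' sub show False by blast
    qed
    with not_adj aT show ?thesis by blast
  qed
  \<comment> \<open>An edge avoiding \<open>c\<close> can be read in both directions: one reading of
    \<open>key\<close> makes \<open>u\<close> adjacent to \<open>c\<close>, the other forbids
    it.\<close>
  have edge: "u = c \<or> v = c" if "u \<rightarrow>\<^bsub>H\<^esub> v" for u v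
    using key[of u v] key[of v u] that sym by blast
  have spoke: "c \<rightarrow>\<^bsub>H\<^esub> v \<and> v \<rightarrow>\<^bsub>H\<^esub> c" if "v \<in> verts H" "v \<noteq> c" for v
    using has_neighbor[OF that(1)] edge sym that(2) by blast
  have "arcs_ends H = (verts H - {c}) \<times> {c} \<union> {c} \<times> (verts H - {c})"
  proof (rule set_eqI, rule iffI)
    fix p assume "p \<in> arcs_ends H"
    then show "p \<in> (verts H - {c}) \<times> {c} \<union> {c} \<times> (verts H - {c})"
      using edge adj_in_verts adj_not_same by (cases p) blast
  next
    fix p assume "p \<in> (verts H - {c}) \<times> {c} \<union> {c} \<times> (verts H - {c})"
    then show "p \<in> arcs_ends H" using spoke by auto
  qed
  with H cV show ?thesis by (simp add: star_centered_def)
qed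

section \<open>Comparing coefficients\<close>

theorem theorem26:
  fixes n :: nat and G :: "('a, 'b) pre_digraph"
  assumes "n \<ge> 4"
    and "K\<^bsub>n - 1,1\<^esub> G"
  shows "P_unique TYPE(('c, 'd) pre_digraph) G"
  unfolding P_unique_def
proof (intro conjI allI impI)
  show "graph G" using assms(2) by (simp add: complete_bipartite_digraph_def)
  then interpret graph G .
  obtain c where star: "star_centered G c" and nG: "card (verts G) = n"
    using complete_bipartite_digraph_star_centered[OF assms(2)] assms(1) by auto
  have cV: "c \<in> verts G" using star by (simp add: star_centered_def)
  fix H :: "('c, 'd) pre_digraph"
  assume "graph H \<and> power_dom_poly H = power_dom_poly G"
  then have H: "graph H" and poly: "power_dom_poly H = power_dom_poly G" by auto
  interpret H: graph H by fact
  have nH: "card (verts H) = n"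
    using degree_power_dom_poly[OF H] degree_power_dom_poly[OF \<open>graph G\<close>] poly nG by simp
  have num: "num_power_dominating H i = num_power_dominating G i" if "i \<in> {1..n}" for i
    using arg_cong[OF poly, of "\<lambda>p. coeff p i"] that nG nH by (simp add: coeff_power_dom_poly)
  have finG: "finite {S. power_dominating G S \<and> card S = i}" for i
    by (rule finite_subset[of _ "Pow (verts G)"]) (auto simp: power_dominating_def)
  have finH: "finite {S. power_dominating H S \<and> card S = i}" for i
    by (rule finite_subset[of _ "Pow (verts H)"]) (auto simp: power_dominating_def)
  \<comment> \<open>The coefficient at 1 is nonzero for the star, which yields a power dominating
    singleton of \<open>H\<close>.\<close>
  have "{c} \<in> {S. power_dominating G S \<and> card S = 1}"
    using star_power_dominating_center[OF star] cV by auto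
  then have "num_power_dominating G 1 \<noteq> 0"
    using finG[of 1] unfolding num_power_dominating_def by (metis card_0_eq empty_iff)
  then have "{S. power_dominating H S \<and> card S = 1} \<noteq> {}"
    using num[of 1] assms(1) unfolding num_power_dominating_def
    by (metis atLeastAtMost_iff card.empty le_refl one_le_numeral order_trans)
  then obtain d where d: "power_dominating H {d}" by (auto simp: card_1_singleton_iff)
  have dV: "d \<in> verts H" using d by (simp add: power_dominating_def)
  \<comment> \<open>The relevant size \<open>n - 3\<close> is written \<open>Suc k\<close> to fit
    the counting lemma. It is positive since \<open>n\<close> is at least 4, so the polynomial
    records its count.\<close>
  define k where "k = n - 4"
  have k: "Suc k + 3 = n" using assms(1) by (simp add: k_def)
  have "c \<in> S" if "power_dominating G S" "card S = Suc k" for S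
    using star_not_power_dominating[OF star, of S] that k nG by linarith
  then have "{S. power_dominating G S \<and> card S = Suc k} =
      {S. S \<subseteq> verts G \<and> c \<in> S \<and> card S = Suc k}"
    using star_power_dominating_center[OF star] power_dominating_subset by blast
  then have "num_power_dominating G (Suc k) = (n - 1) choose k"
    unfolding num_power_dominating_def
    using card_supersets_singleton[OF finite_verts cV nG] by simp
  then have "card {S. power_dominating H S \<and> card S = Suc k} =
      card {S. S \<subseteq> verts H \<and> d \<in> S \<and> card S = Suc k}"
    using num[of "Suc k"] k card_supersets_singleton[OF H.finite_verts dV nH]
    by (simp add: num_power_dominating_def)
  moreover have "{S. S \<subseteq> verts H \<and> d \<in> S \<and> card S = Suc k} \<subseteq>
      {S. power_dominating H S \<and> card S = Suc k}"
    using power_dominating_mono[OF d] H.wf_digraph by auto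
  \<comment> \<open>The supersets of \<open>d\<close> of this size all power dominate and are as
    numerous as the power dominating sets of this size, so there are no others.\<close>
  ultimately have eq: "{S. S \<subseteq> verts H \<and> d \<in> S \<and> card S = Suc k} =
      {S. power_dominating H S \<and> card S = Suc k}"
    by (intro card_subset_eq[OF finH]) simp_all
  have "star_centered H d"
  proof (rule star_centeredI[OF H d])
    show "card (verts H) \<ge> 4" using nH assms(1) by simp
    fix S assume "S \<subseteq> verts H" "d \<notin> S" "card S + 3 = card (verts H)"
    then show "\<not> power_dominating H S" using eq k nH by auto
  qed
  then show "digraph_iso H G" using star nG nH star_centered_iso by metis
qed

end
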